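(* Let $B$ be an Alexandroff space and let $F$ be a topological space. Let $D\colon B\to \mathbf{Top}$ be a functor. For each $b\in B$ let $\sigma_b\colon D(b) \to \mathbf{K} D(b)$ be the quotient map to the Kolmogorov quotient. Then $\pi_B\colon \int D\to B$ is a fiber bundle over $B$ with fiber $F$ if and only if each of the following holds. (a) $\mathbf{K} D\colon B\to \mathbf{Top}_0$ is a morphism-inverting functor. (b) For all $b\in B$, $D(b)$ is homeomorphic to $F$. (c) For all $b_1,b_2\in B$ such that $b_1\leq b_2$ and for all $y\in \mathbf{K} D(b_2)$, there exists a bijective function $f_{b_1,b_2,y}\colon \sigma_{b_1}^{-1}\big((\mathbf{K} D(b_1\leq b_2))^{-1}(y)\big)\to \sigma_{b_2}^{-1}(y)$.
   Context: An Alexandroff space is a topological space in which arbitrary intersections of open sets are open. In an Alexandroff space $X$ each $x$ has a minimal open neighbourhood $U_x$, and $x\leq y \iff U_x\subseteq U_y$ defines a preorder; the open sets are exactly the lower sets and $U_x=\{y\in X : y\leq x\}$. An Alexandroff space is thereby identified with a preordered set and regarded as a thin category with a unique arrow (denoted $x\leq y$) from $x$ to $y$ whenever $x\leq y$. $\mathbf{Top}$ is the category of topological spaces and continuous maps; $\mathbf{Top}_0$ is its full subcategory of T$_0$-spaces. A functor is morphism-inverting if it sends every arrow to an isomorphism. The Kolmogorov quotient functor $\mathbf{K}\colon\mathbf{Top}\to\mathbf{Top}_0$ sends $X$ to the quotient of $X$ identifying topologically indistinguishable points, with quotient map $\sigma_X\colon X\to\mathbf{K}X$, and sends $f\colon X\to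 Y$ to the unique continuous map $\mathbf{K}(f)$ with $\mathbf{K}(f)\sigma_X=\sigma_Yf$. $\mathbf{K}D$ denotes the composite functor $\mathbf{K}\circ D$. Topological Grothendieck construction: for a functor $D\colon B\to\mathbf{Top}$ from an Alexandroff space $B$, $\int D=\bigcup_{b\in B}\{b\}\times D(b)$, with the topology having as basis the sets $J_D(b,V)=\bigcup_{v\in U_b}\{v\}\times D(v\leq b)^{-1}(V)$, for $b\in B$ and $V\subseteq D(b)$ open. The projection $\pi_B\colon\int D\to B$ is $\pi_B(b,x)=b$. A fiber bundle over $B$ with fiber $F$ is a continuous map $p\colon E\to B$ such that every $b\in B$ has an open neighbourhood $U$ with a homeomorphism $p^{-1}(U)\to U\times F$ commuting with the maps to $U$. *)

theory Defs
  imports "HOL-Analysis.Analysis"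
begin

section \<open>Alexandroff spaces\<close>

text \<open>The intersection with \<^term>\<open>topspace B\<close> only matters for the empty family, whose
  intersection inside the space is the whole space.\<close>

definition Alexandroff_space :: "'b topology \<Rightarrow> bool" where
  "Alexandroff_space B \<longleftrightarrow>
     (\<forall>\<U>. (\<forall>U\<in>\<U>. openin B U) \<longrightarrow> openin B (topspace B \<inter> \<Inter>\<U>))"

definition min_nbhd :: "'b topology \<Rightarrow> 'b \<Rightarrow> 'b set" where
  "min_nbhd B x = \<Inter>{U. openin B U \<and> x \<in> U}"

definition spec_le :: "'b topology \<Rightarrow> 'b \<Rightarrow> 'b \<Rightarrow> bool" where
  "spec_le B x y \<longleftrightarrow> x \<in> topspace B \<and> y \<in> topspace B \<and> min_nbhd B x \<subseteq> min_nbhd B y"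

lemma min_nbhd_self: "x \<in> min_nbhd B x"
  by (simp add: min_nbhd_def)

lemma min_nbhd_subset_openin: "openin B U \<Longrightarrow> x \<in> U \<Longrightarrow> min_nbhd B x \<subseteq> U"
  by (auto simp: min_nbhd_def)

lemma openin_min_nbhd:
  assumes "Alexandroff_space B" "x \<in> topspace B"
  shows "openin B (min_nbhd B x)"
proof -
  have "topspace B \<inter> min_nbhd B x = min_nbhd B x"
    using min_nbhd_subset_openin[OF openin_topspace assms(2)] by blast
  then show ?thesis
    using assms(1)[unfolded Alexandroff_space_def, rule_format, of "{U. openin B U \<and> x \<in> U}"]
    by (simp add: min_nbhd_def)
qed

lemma mem_min_nbhd_iff:
  assumes "Alexandroff_space B" "b \<in> topspace B"
  shows "v \<in> min_nbhd B b \<longleftrightarrow> spec_le B v b"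
proof
  assume v: "v \<in> min_nbhd B b"
  have op: "openin B (min_nbhd B b)"
    by (rule openin_min_nbhd[OF assms])
  then have "min_nbhd B v \<subseteq> min_nbhd B b"
    using v by (rule min_nbhd_subset_openin)
  with v openin_subset[OF op] assms(2) show "spec_le B v b"
    by (auto simp: spec_le_def)
next
  assume "spec_le B v b"
  then show "v \<in> min_nbhd B b"
    using min_nbhd_self[of v B] by (auto simp: spec_le_def)
qed

lemma spec_le_refl: "b \<in> topspace B \<Longrightarrow> spec_le B b b"
  by (simp add: spec_le_def)

lemma spec_le_trans: "spec_le B x y \<Longrightarrow> spec_le B y z \<Longrightarrow> spec_le B x z"
  by (auto simp: spec_le_def)

section \<open>Functors from an Alexandroff space to topological spaces\<close>

text \<open>A functor on the thin category of \<^term>\<open>B\<close> is given by its object map \<^term>\<open>D\<close> and its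
  arrow map \<^term>\<open>Dm\<close>, where \<^term>\<open>Dm b1 b2\<close> is the image of the unique arrow from \<^term>\<open>b1\<close> to
  \<^term>\<open>b2\<close> and is only meaningful on \<^term>\<open>topspace (D b1)\<close>.  All the spaces \<^term>\<open>D b\<close> are
  carried by arbitrary subsets of one type, which loses no generality: a family of spaces embeds
  in its disjoint union.\<close>

definition functor_to_Top ::
  "'b topology \<Rightarrow> ('b \<Rightarrow> 'a topology) \<Rightarrow> ('b \<Rightarrow> 'b \<Rightarrow> 'a \<Rightarrow> 'a) \<Rightarrow> bool" where
  "functor_to_Top B D Dm \<longleftrightarrow>
     (\<forall>b1 b2. spec_le B b1 b2 \<longrightarrow> continuous_map (D b1) (D b2) (Dm b1 b2)) \<and>
     (\<forall>b\<in>topspace B. \<forall>x\<in>topspace (D b). Dm b b x = x) \<and>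
     (\<forall>b1 b2 b3. spec_le B b1 b2 \<longrightarrow> spec_le B b2 b3 \<longrightarrow>
        (\<forall>x\<in>topspace (D b1). Dm b1 b3 x = Dm b2 b3 (Dm b1 b2 x)))"

definition functor_to_Top0 ::
  "'b topology \<Rightarrow> ('b \<Rightarrow> 'a topology) \<Rightarrow> ('b \<Rightarrow> 'b \<Rightarrow> 'a \<Rightarrow> 'a) \<Rightarrow> bool" where
  "functor_to_Top0 B D Dm \<longleftrightarrow> functor_to_Top B D Dm \<and> (\<forall>b\<in>topspace B. t0_space (D b))"

text \<open>Isomorphisms in the category of spaces, and in its full subcategory of T0 spaces, are the
  homeomorphisms.\<close>

definition morphism_inverting ::
  "'b topology \<Rightarrow> ('b \<Rightarrow> 'a topology) \<Rightarrow> ('b \<Rightarrow> 'b \<Rightarrow> 'a \<Rightarrow> 'a) \<Rightarrow> bool" where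
  "morphism_inverting B D Dm \<longleftrightarrow>
     (\<forall>b1 b2. spec_le B b1 b2 \<longrightarrow> homeomorphic_map (D b1) (D b2) (Dm b1 b2))"

section \<open>The Kolmogorov quotient functor\<close>

text \<open>The library function \<^term>\<open>Kolmogorov_quotient X\<close> is the quotient map: it sends a point to a
  chosen representative of its class of topologically indistinguishable points.  The quotient space
  is the set of representatives; its subspace topology is the quotient topology by
  \<open>quotient_map_Kolmogorov_quotient\<close>, and the fibres are the classes by
  \<open>Kolmogorov_quotient_eq\<close>.\<close>

definition Kspace :: "'a topology \<Rightarrow> 'a topology" where
  "Kspace X = subtopology X (Kolmogorov_quotient X ` topspace X)"

definition Kmap :: "'a topology \<Rightarrow> 'c topology \<Rightarrow> ('a \<Rightarrow> 'c) \<Rightarrow> 'a \<Rightarrow> 'c" where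
  "Kmap X Y f = (THE g. g \<in> extensional (topspace (Kspace X)) \<and>
      continuous_map (Kspace X) (Kspace Y) g \<and>
      (\<forall>x\<in>topspace X. g (Kolmogorov_quotient X x) = Kolmogorov_quotient Y (f x)))"

lemma topspace_Kspace: "topspace (Kspace X) = Kolmogorov_quotient X ` topspace X"
  by (auto simp: Kspace_def Kolmogorov_quotient_in_topspace)

lemma quotient_map_Kspace: "quotient_map X (Kspace X) (Kolmogorov_quotient X)"
  by (simp add: Kspace_def quotient_map_Kolmogorov_quotient)

lemma t0_space_Kspace: "t0_space (Kspace X)"
  by (simp add: Kspace_def t0_space_Kolmogorov_quotient)

lemma Kmap_ex1:
  assumes f: "continuous_map X Y f"
  shows "\<exists>!g. g \<in> extensional (topspace (Kspace X)) \<and>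
      continuous_map (Kspace X) (Kspace Y) g \<and>
      (\<forall>x\<in>topspace X. g (Kolmogorov_quotient X x) = Kolmogorov_quotient Y (f x))"
    (is "\<exists>!g. ?P g")
proof (rule ex_ex1I)
  have "continuous_map X (Kspace Y) (Kolmogorov_quotient Y \<circ> f)"
    using f quotient_imp_continuous_map[OF quotient_map_Kspace] by (rule continuous_map_compose)
  then obtain g where g: "continuous_map (Kspace X) (Kspace Y) g"
      "\<And>x. x \<in> topspace X \<Longrightarrow> g (Kolmogorov_quotient X x) = (Kolmogorov_quotient Y \<circ> f) x"
    using Kolmogorov_quotient_lift_exists[of "topspace X" X "Kspace Y" "Kolmogorov_quotient Y \<circ> f"]
      t0_space_Kspace[of Y] by (auto simp: Kspace_def)
  have "continuous_map (Kspace X) (Kspace Y) (restrict g (topspace (Kspace X)))"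
    using g(1) by (rule continuous_map_eq) simp
  then have ex: "?P (restrict g (topspace (Kspace X)))"
    using g(2) by (simp add: topspace_Kspace)
  then show "\<exists>g. ?P g"
    by (intro exI[of ?P "restrict g (topspace (Kspace X))"])
next
  fix g h assume "?P g" "?P h"
  then show "g = h"
    by (intro extensionalityI[of g "topspace (Kspace X)"]) (auto simp: topspace_Kspace)
qed

lemma Kmap:
  assumes "continuous_map X Y f"
  shows "continuous_map (Kspace X) (Kspace Y) (Kmap X Y f)"
    and "x \<in> topspace X \<Longrightarrow>
      Kmap X Y f (Kolmogorov_quotient X x) = Kolmogorov_quotient Y (f x)"
  using theI'[OF Kmap_ex1[OF assms]] unfolding Kmap_def by blast+

section \<open>The topological Grothendieck construction\<close>

definition Groth_basic ::
  "'b topology \<Rightarrow> ('b \<Rightarrow> 'a topology) \<Rightarrow> ('b \<Rightarrow> 'b \<Rightarrow> 'a \<Rightarrow> 'a) \<Rightarrow> 'b \<Rightarrow> 'a set \<Rightarrow> ('b \<times> 'a) set" where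
  "Groth_basic B D Dm b V = (SIGMA v:min_nbhd B b. {x \<in> topspace (D v). Dm v b x \<in> V})"

definition Groth ::
  "'b topology \<Rightarrow> ('b \<Rightarrow> 'a topology) \<Rightarrow> ('b \<Rightarrow> 'b \<Rightarrow> 'a \<Rightarrow> 'a) \<Rightarrow> ('b \<times> 'a) topology" where
  "Groth B D Dm = topology (arbitrary union_of
     (\<lambda>S. \<exists>b\<in>topspace B. \<exists>V. openin (D b) V \<and> S = Groth_basic B D Dm b V))"

text \<open>The two facts below confirm that the basic sets really form a basis of a topology on the
  expected point set.\<close>

lemma openin_Groth:
  assumes B: "Alexandroff_space B" and D: "functor_to_Top B D Dm"
  shows "openin (Groth B D Dm) = arbitrary union_of
     (\<lambda>S. \<exists>b\<in>topspace B. \<exists>V. openin (D b) V \<and> S = Groth_basic B D Dm b V)"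
    (is "_ = arbitrary union_of ?P")
proof -
  have cont: "\<And>v b. spec_le B v b \<Longrightarrow> continuous_map (D v) (D b) (Dm v b)"
    and ident: "\<And>b x. b \<in> topspace B \<Longrightarrow> x \<in> topspace (D b) \<Longrightarrow> Dm b b x = x"
    and comp: "\<And>u v b x. spec_le B u v \<Longrightarrow> spec_le B v b \<Longrightarrow> x \<in> topspace (D u) \<Longrightarrow>
        Dm u b x = Dm v b (Dm u v x)"
    using D by (auto simp: functor_to_Top_def)
  have "(arbitrary union_of ?P) (S \<inter> T)" if S: "?P S" and T: "?P T" for S T
  proof -
    obtain b V where b: "b \<in> topspace B" "openin (D b) V" "S = Groth_basic B D Dm b V"
      using S by blast
    obtain c W where c: "c \<in> topspace B" "openin (D c) W" "T = Groth_basic B D Dm c W"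
      using T by blast
    have "\<exists>R. ?P R \<and> z \<in> R \<and> R \<subseteq> S \<inter> T" if z: "z \<in> S \<inter> T" for z
    proof -
      obtain v x where zvx: "z = (v, x)" by fastforce
      then have v: "spec_le B v b" "spec_le B v c"
        and x: "x \<in> topspace (D v)" "Dm v b x \<in> V" "Dm v c x \<in> W"
        using z b c mem_min_nbhd_iff[OF B] by (auto simp: Groth_basic_def)
      have vB: "v \<in> topspace B" using v(1) by (simp add: spec_le_def)
      define Q where "Q = {x \<in> topspace (D v). Dm v b x \<in> V} \<inter> {x \<in> topspace (D v). Dm v c x \<in> W}"
      have Q: "openin (D v) Q"
        unfolding Q_def using cont[OF v(1)] cont[OF v(2)] b(2) c(2)
        by (intro openin_Int openin_continuous_map_preimage)
      have "?P (Groth_basic B D Dm v Q)" using vB Q by blast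
      moreover have "z \<in> Groth_basic B D Dm v Q"
        using x ident[OF vB x(1)] by (simp add: zvx Groth_basic_def Q_def min_nbhd_self)
      moreover have "Groth_basic B D Dm v Q \<subseteq> S \<inter> T"
      proof
        fix w assume w: "w \<in> Groth_basic B D Dm v Q"
        obtain u y where uy: "w = (u, y)" by fastforce
        have u: "spec_le B u v" and y: "y \<in> topspace (D u)" "Dm u v y \<in> Q"
          using w mem_min_nbhd_iff[OF B vB] by (auto simp: uy Groth_basic_def)
        have "spec_le B u b" "spec_le B u c"
          using spec_le_trans[OF u v(1)] spec_le_trans[OF u v(2)] by auto
        moreover have "Dm u b y \<in> V" "Dm u c y \<in> W"
          using y comp[OF u v(1) y(1)] comp[OF u v(2) y(1)] by (auto simp: Q_def)
        ultimately show "w \<in> S \<inter> T"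
          using y(1) mem_min_nbhd_iff[OF B] b c by (auto simp: uy Groth_basic_def)
      qed
      ultimately show ?thesis by blast
    qed
    then show ?thesis
      unfolding arbitrary_union_of_alt by blast
  qed
  then have "istopology (arbitrary union_of ?P)"
    by (simp add: istopology_base_eq)
  then show ?thesis
    unfolding Groth_def by (rule topology_inverse')
qed

lemma topspace_Groth:
  assumes B: "Alexandroff_space B" and D: "functor_to_Top B D Dm"
  shows "topspace (Groth B D Dm) = (SIGMA b:topspace B. topspace (D b))"
proof
  show "topspace (Groth B D Dm) \<subseteq> (SIGMA b:topspace B. topspace (D b))"
  proof
    fix z assume "z \<in> topspace (Groth B D Dm)"
    then obtain b V where "b \<in> topspace B" "z \<in> Groth_basic B D Dm b V"
      using openin_topspace[of "Groth B D Dm"]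
      unfolding openin_Groth[OF assms] arbitrary_union_of_alt by blast
    then show "z \<in> (SIGMA b:topspace B. topspace (D b))"
      using mem_min_nbhd_iff[OF B] by (auto simp: Groth_basic_def spec_le_def)
  qed
  show "(SIGMA b:topspace B. topspace (D b)) \<subseteq> topspace (Groth B D Dm)"
  proof clarify
    fix b x assume b: "b \<in> topspace B" "x \<in> topspace (D b)"
    have "openin (Groth B D Dm) (Groth_basic B D Dm b (topspace (D b)))"
      unfolding openin_Groth[OF assms] by (rule arbitrary_union_of_inc) (use b in blast)
    moreover have "(b, x) \<in> Groth_basic B D Dm b (topspace (D b))"
      using b D by (simp add: Groth_basic_def min_nbhd_self functor_to_Top_def)
    ultimately show "(b, x) \<in> topspace (Groth B D Dm)"
      using openin_subset by blast
  qed
qed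

section \<open>Fiber bundles\<close>

definition fiber_bundle ::
  "'e topology \<Rightarrow> 'b topology \<Rightarrow> 'f topology \<Rightarrow> ('e \<Rightarrow> 'b) \<Rightarrow> bool" where
  "fiber_bundle E B F p \<longleftrightarrow>
     continuous_map E B p \<and>
     (\<forall>b\<in>topspace B. \<exists>U h. openin B U \<and> b \<in> U \<and>
        homeomorphic_map (subtopology E {x \<in> topspace E. p x \<in> U})
          (prod_topology (subtopology B U) F) h \<and>
        (\<forall>x\<in>topspace E. p x \<in> U \<longrightarrow> fst (h x) = p x))"

end

theory Submission
  imports Defs
begin

text \<open>The point is that (a) and (c) together say: every \<open>D(b\<^sub>1 \<le> b\<^sub>2)\<close> is pointwise topologically
  indistinguishable from some homeomorphism \<open>D(b\<^sub>1) \<rightarrow> D(b\<^sub>2)\<close>.  Since open sets cannot see the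
  difference, composing these homeomorphisms (chosen with no compatibility) with \<open>D(b) \<cong> F\<close>
  trivializes the construction over \<open>U\<^sub>b\<close>.  Conversely, a point \<open>(b\<^sub>1, x)\<close> lies
  in every open set containing \<open>(b\<^sub>2, D(b\<^sub>1 \<le> b\<^sub>2) x)\<close>, and \<open>(b\<^sub>1, y)\<close> lies in every open set
  containing \<open>(b\<^sub>2, y)\<close> in a product; comparing the two in a trivialization shows
  that it intertwines \<open>D(b\<^sub>1 \<le> b\<^sub>2)\<close> with the identity of \<open>F\<close> up to indistinguishability.\<close>

section \<open>Functoriality of the Kolmogorov quotient\<close>

text \<open>The description defining \<open>Kmap\<close> mentions \<open>f\<close> only through its
  composite with the quotient map of \<open>Y\<close>, so replacing values by indistinguishable ones
  changes nothing.\<close>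

lemma Kmap_cong:
  assumes "\<And>x. x \<in> topspace X \<Longrightarrow> Kolmogorov_quotient Y (f x) = Kolmogorov_quotient Y (g x)"
  shows "Kmap X Y f = Kmap X Y g"
  unfolding Kmap_def using assms by (simp cong: ball_cong)

lemma Kmap_id:
  assumes "continuous_map X X f" "\<And>x. x \<in> topspace X \<Longrightarrow> f x = x" "z \<in> topspace (Kspace X)"
  shows "Kmap X X f z = z"
  using assms Kmap(2)[OF assms(1)] by (auto simp: topspace_Kspace)

lemma Kmap_compose:
  assumes f: "continuous_map X Y f" and g: "continuous_map Y Z g" and h: "continuous_map X Z h"
    and eq: "\<And>x. x \<in> topspace X \<Longrightarrow> h x = g (f x)"
    and z: "z \<in> topspace (Kspace X)"
  shows "Kmap X Z h z = Kmap Y Z g (Kmap X Y f z)"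
proof -
  obtain x where x: "x \<in> topspace X" "z = Kolmogorov_quotient X x"
    using z by (auto simp: topspace_Kspace)
  then have "f x \<in> topspace Y"
    using f by (auto simp: continuous_map_def)
  then show ?thesis
    using x eq Kmap(2)[OF f] Kmap(2)[OF g] Kmap(2)[OF h] by simp
qed

text \<open>Settles the functor clause of (a): identities and composites can be checked on
  representatives in \<open>D b\<close>, where the laws of \<open>D\<close> apply.\<close>

lemma functor_to_Top0_Kspace:
  assumes "functor_to_Top B D Dm"
  shows "functor_to_Top0 B (\<lambda>b. Kspace (D b)) (\<lambda>b1 b2. Kmap (D b1) (D b2) (Dm b1 b2))"
proof -
  have cont: "\<And>b c. spec_le B b c \<Longrightarrow> continuous_map (D b) (D c) (Dm b c)"
    and ident: "\<And>b x. b \<in> topspace B \<Longrightarrow> x \<in> topspace (D b) \<Longrightarrow> Dm b b x = x"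
    and comp: "\<And>b c d x. spec_le B b c \<Longrightarrow> spec_le B c d \<Longrightarrow> x \<in> topspace (D b) \<Longrightarrow>
        Dm b d x = Dm c d (Dm b c x)"
    using assms by (auto simp: functor_to_Top_def)
  show ?thesis
    unfolding functor_to_Top0_def functor_to_Top_def
  proof (intro conjI allI ballI impI)
    fix b z assume "b \<in> topspace B" "z \<in> topspace (Kspace (D b))"
    then show "Kmap (D b) (D b) (Dm b b) z = z"
      using Kmap_id cont spec_le_refl ident by metis
  next
    fix b c d z
    assume le: "spec_le B b c" "spec_le B c d" and z: "z \<in> topspace (Kspace (D b))"
    show "Kmap (D b) (D d) (Dm b d) z = Kmap (D c) (D d) (Dm c d) (Kmap (D b) (D c) (Dm b c) z)"
      by (rule Kmap_compose[OF cont[OF le(1)] cont[OF le(2)] cont[OF spec_le_trans[OF le]] comp[OF le] z])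
  qed (use Kmap(1)[OF cont] t0_space_Kspace in auto)
qed

lemma homeomorphic_map_Kmap:
  assumes "homeomorphic_map X Y f"
  shows "homeomorphic_map (Kspace X) (Kspace Y) (Kmap X Y f)"
proof -
  obtain g where fg: "homeomorphic_maps X Y f g"
    using assms homeomorphic_map_maps by blast
  then have c: "continuous_map X Y f" "continuous_map Y X g"
    and inv: "\<And>x. x \<in> topspace X \<Longrightarrow> g (f x) = x" "\<And>y. y \<in> topspace Y \<Longrightarrow> f (g y) = y"
    by (auto simp: homeomorphic_maps_def)
  have "Kmap Y X g (Kmap X Y f z) = z" if "z \<in> topspace (Kspace X)" for z
    using Kmap_compose[OF c continuous_map_id _ that] Kmap_id[OF continuous_map_id _ that] inv
    by simp
  moreover have "Kmap X Y f (Kmap Y X g z) = z" if "z \<in> topspace (Kspace Y)" for z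
    using Kmap_compose[OF c(2,1) continuous_map_id _ that] Kmap_id[OF continuous_map_id _ that] inv
    by simp
  ultimately have "homeomorphic_maps (Kspace X) (Kspace Y) (Kmap X Y f) (Kmap Y X g)"
    using Kmap(1)[OF c(1)] Kmap(1)[OF c(2)] by (simp add: homeomorphic_maps_def)
  then show ?thesis
    using homeomorphic_map_maps by blast
qed

section \<open>Maps indistinguishable from a homeomorphism\<close>

text \<open>A space and its quotient have corresponding open sets, so \<open>W\<close> can be
  carried to the quotient of \<open>X\<close>, across the homeomorphism, and back to
  \<open>Y\<close>. Thus \<open>X\<close> has the topology induced by \<open>f\<close>, which later
  makes the glued map open.\<close>

lemma openin_eq_preimage_if_homeomorphic_Kmap:
  assumes f: "continuous_map X Y f"
    and K: "homeomorphic_map (Kspace X) (Kspace Y) (Kmap X Y f)"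
    and W: "openin X W"
  obtains V where "openin Y V" "W = {x \<in> topspace X. f x \<in> V}"
proof
  let ?k = "Kmap X Y f" and ?p = "Kolmogorov_quotient X" and ?q = "Kolmogorov_quotient Y"
  have "openin (Kspace X) (?p ` W)"
    using W open_map_Kolmogorov_quotient[of X] by (simp add: open_map_def Kspace_def)
  then have "openin (Kspace Y) (?k ` ?p ` W)"
    using homeomorphic_imp_open_map[OF K] by (simp add: open_map_def)
  then show "openin Y {y \<in> topspace Y. ?q y \<in> ?k ` ?p ` W}"
    by (rule openin_continuous_map_preimage[OF quotient_imp_continuous_map[OF quotient_map_Kspace]])
  have "x \<in> W \<longleftrightarrow> ?q (f x) \<in> ?k ` ?p ` W" if x: "x \<in> topspace X" for x
  proof
    assume "?q (f x) \<in> ?k ` ?p ` W"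
    then obtain w where w: "w \<in> W" "?k (?p x) = ?k (?p w)"
      using Kmap(2)[OF f x] by auto
    then have "?p x = ?p w"
      using homeomorphic_imp_injective_map[OF K] x openin_subset[OF W]
      by (auto simp: topspace_Kspace inj_on_eq_iff)
    \<comment> \<open>Open sets are unions of indistinguishability classes, so \<open>x\<close>
      follows \<open>w\<close> into \<open>W\<close>.\<close>
    then show "x \<in> W"
      using w(1) W Kolmogorov_quotient_eq by metis
  qed (metis Kmap(2)[OF f x] image_eqI)
  moreover have "f x \<in> topspace Y" if "x \<in> topspace X" for x
    using f that by (auto simp: continuous_map_def)
  ultimately show "W = {x \<in> topspace X. f x \<in> {y \<in> topspace Y. ?q y \<in> ?k ` ?p ` W}}"
    using openin_subset[OF W] by blast
qed

text \<open>Merges (a) and (c) for a single arrow. Fibre bijections glue to a bijection that open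
  sets cannot tell from \<open>f\<close>; it is continuous because \<open>f\<close> is, and open
  because every open set of \<open>X\<close> is a preimage under \<open>f\<close>. Conversely,
  \<open>\<phi>\<close> induces the same map of quotients as \<open>f\<close>, and its restrictions
  are the fibre bijections.\<close>

lemma homeomorphic_Kmap_fibres_iff:
  assumes f: "continuous_map X Y f"
  shows "homeomorphic_map (Kspace X) (Kspace Y) (Kmap X Y f) \<and>
      (\<forall>y\<in>topspace (Kspace Y). \<exists>g. bij_betw g
          {x \<in> topspace X. Kolmogorov_quotient X x \<in>
             {z \<in> topspace (Kspace X). Kmap X Y f z = y}}
          {x \<in> topspace Y. Kolmogorov_quotient Y x = y}) \<longleftrightarrow>
    (\<exists>\<phi>. homeomorphic_map X Y \<phi> \<and>
      (\<forall>x\<in>topspace X. Kolmogorov_quotient Y (\<phi> x) = Kolmogorov_quotient Y (f x)))"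
    (is "?K \<and> ?fib \<longleftrightarrow> ?R")
proof -
  let ?q = "Kolmogorov_quotient Y"
  have fY: "f x \<in> topspace Y" if "x \<in> topspace X" for x
    using f that by (auto simp: continuous_map_def)
  \<comment> \<open>The naturality square of \<open>Kmap\<close> turns the two-stage preimage of (c)
    into one fibre of \<open>?q \<circ> f\<close>.\<close>
  have fibre: "{x \<in> topspace X. Kolmogorov_quotient X x \<in>
        {z \<in> topspace (Kspace X). Kmap X Y f z = y}} = {x \<in> topspace X. ?q (f x) = y}" for y
    using Kmap(2)[OF f] quotient_imp_surjective_map[OF quotient_map_Kspace[of X]] by auto
  have fib: "?fib \<longleftrightarrow> (\<forall>y\<in>topspace (Kspace Y). \<exists>g. bij_betw g
      {x \<in> topspace X. ?q (f x) = y} {x \<in> topspace Y. ?q x = y})"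
    unfolding fibre ..
  show ?thesis
  proof
    assume ?R
    then obtain \<phi> where hom: "homeomorphic_map X Y \<phi>"
      and eq: "\<And>x. x \<in> topspace X \<Longrightarrow> ?q (\<phi> x) = ?q (f x)"
      by blast
    have ?K
      using homeomorphic_map_Kmap[OF hom] Kmap_cong[of X Y \<phi> f] eq by simp
    moreover have "bij_betw \<phi> {x \<in> topspace X. ?q (f x) = y} {x \<in> topspace Y. ?q x = y}" for y
    proof (rule bij_betw_subset)
      show "bij_betw \<phi> (topspace X) (topspace Y)"
        using homeomorphic_imp_injective_map[OF hom] homeomorphic_imp_surjective_map[OF hom]
        by (simp add: bij_betw_def)
      show "\<phi> ` {x \<in> topspace X. ?q (f x) = y} = {x \<in> topspace Y. ?q x = y}"
        unfolding homeomorphic_imp_surjective_map[OF hom, symmetric] using eq by auto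
    qed blast
    ultimately show "?K \<and> ?fib"
      unfolding fib by blast
  next
    assume L: "?K \<and> ?fib"
    obtain g where g: "\<And>y. y \<in> topspace (Kspace Y) \<Longrightarrow>
        bij_betw (g y) {x \<in> topspace X. ?q (f x) = y} {x \<in> topspace Y. ?q x = y}"
      using bchoice[OF L[THEN conjunct2, unfolded fib]] by blast
    \<comment> \<open>The fibres of \<open>?q \<circ> f\<close> partition \<open>X\<close>; each
      point is moved by the bijection belonging to its own fibre.\<close>
    define \<phi> where "\<phi> x = g (?q (f x)) x" for x
    have K: "?q y \<in> topspace (Kspace Y)" if "y \<in> topspace Y" for y
      using that by (simp add: topspace_Kspace)
    have \<phi>: "\<phi> x \<in> topspace Y \<and> ?q (\<phi> x) = ?q (f x)" if "x \<in> topspace X" for x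
      using bij_betwE[OF g[OF K[OF fY[OF that]]]] that by (auto simp: \<phi>_def)
    have inj: "inj_on \<phi> (topspace X)"
    proof (rule inj_onI)
      fix x x' assume x: "x \<in> topspace X" "x' \<in> topspace X" "\<phi> x = \<phi> x'"
      \<comment> \<open>Equal images have equal classes, so both points lie in one fibre, where a
        single bijection is applied.\<close>
      then have "?q (f x) = ?q (f x')"
        using \<phi> by metis
      then show "x = x'"
        using x bij_betw_imp_inj_on[OF g[OF K[OF fY[OF x(1)]]]] by (auto simp: \<phi>_def inj_on_def)
    qed
    have surj: "\<phi> ` topspace X = topspace Y"
    proof
      show "topspace Y \<subseteq> \<phi> ` topspace X"
      proof
        fix y assume "y \<in> topspace Y"
        then have "y \<in> g (?q y) ` {x \<in> topspace X. ?q (f x) = ?q y}"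
          using bij_betw_imp_surj_on[OF g[OF K]] by simp
        then show "y \<in> \<phi> ` topspace X"
          by (auto simp: \<phi>_def image_iff) metis
      qed
    qed (use \<phi> in blast)
    have pre: "\<phi> x \<in> V \<longleftrightarrow> f x \<in> V" if "openin Y V" "x \<in> topspace X" for V x
      using \<phi>[OF that(2)] that(1) Kolmogorov_quotient_eq by metis
    have "continuous_map X Y \<phi>"
      using f \<phi> pre by (simp add: continuous_map_def cong: conj_cong)
    moreover have "open_map X Y \<phi>"
      unfolding open_map_def
    proof (intro allI impI)
      fix W assume "openin X W"
      then obtain V where V: "openin Y V" "W = {x \<in> topspace X. f x \<in> V}"
        using openin_eq_preimage_if_homeomorphic_Kmap[OF f] L by blast
      \<comment> \<open>A preimage under \<open>f\<close> of an open set is also its preimage under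
        \<open>\<phi>\<close>; surjectivity then makes \<open>V\<close> the image of
        \<open>W\<close>.\<close>
      then have "W = {x \<in> topspace X. \<phi> x \<in> V}"
        using pre by blast
      then have "\<phi> ` W = \<phi> ` topspace X \<inter> V"
        by blast
      then have "\<phi> ` W = V"
        unfolding surj using openin_subset[OF V(1)] by blast
      then show "openin Y (\<phi> ` W)"
        using V(1) by simp
    qed
    ultimately show ?R
      using bijective_open_imp_homeomorphic_map[OF _ _ surj inj] \<phi> by blast
  qed
qed

section \<open>Open sets of the Grothendieck construction\<close>

locale Top_diagram =
  fixes B :: "'b topology" and D :: "'b \<Rightarrow> 'a topology" and Dm :: "'b \<Rightarrow> 'b \<Rightarrow> 'a \<Rightarrow> 'a"
  assumes Alexandroff: "Alexandroff_space B" and diagram: "functor_to_Top B D Dm"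
begin

lemma continuous_map_Dm: "spec_le B b c \<Longrightarrow> continuous_map (D b) (D c) (Dm b c)"
  and Dm_id: "b \<in> topspace B \<Longrightarrow> x \<in> topspace (D b) \<Longrightarrow> Dm b b x = x"
  and Dm_comp: "spec_le B b c \<Longrightarrow> spec_le B c d \<Longrightarrow> x \<in> topspace (D b) \<Longrightarrow>
      Dm b d x = Dm c d (Dm b c x)"
  using diagram by (auto simp: functor_to_Top_def)

lemma Dm_in_topspace: "spec_le B b c \<Longrightarrow> x \<in> topspace (D b) \<Longrightarrow> Dm b c x \<in> topspace (D c)"
  using continuous_map_Dm by (auto simp: continuous_map_def)

lemma mem_openin_if_spec_le: "openin B U \<Longrightarrow> c \<in> U \<Longrightarrow> spec_le B b c \<Longrightarrow> b \<in> U"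
  using min_nbhd_subset_openin[of B U c] min_nbhd_self[of b B] by (auto simp: spec_le_def)

lemma mem_Groth_basic_iff:
  assumes "b \<in> topspace B"
  shows "(v, x) \<in> Groth_basic B D Dm b V \<longleftrightarrow> spec_le B v b \<and> x \<in> topspace (D v) \<and> Dm v b x \<in> V"
  using mem_min_nbhd_iff[OF Alexandroff assms] by (auto simp: Groth_basic_def)

lemma mem_topspace_Groth: "(b, x) \<in> topspace (Groth B D Dm) \<longleftrightarrow> b \<in> topspace B \<and> x \<in> topspace (D b)"
  by (simp add: topspace_Groth[OF Alexandroff diagram])

lemma openin_Groth_basic:
  "b \<in> topspace B \<Longrightarrow> openin (D b) V \<Longrightarrow> openin (Groth B D Dm) (Groth_basic B D Dm b V)"
  unfolding openin_Groth[OF Alexandroff diagram] by (rule arbitrary_union_of_inc) blast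

text \<open>A basic set at \<open>c\<close> containing \<open>(b, x)\<close> can be shrunk to one at
  \<open>b\<close>: pull \<open>V\<close> back along \<open>Dm b c\<close> and use functoriality.
  Neighbourhoods can therefore be tested with basic sets at the base coordinate of the point
  itself.\<close>

lemma openin_Groth_iff:
  "openin (Groth B D Dm) S \<longleftrightarrow>
    (\<forall>b x. (b, x) \<in> S \<longrightarrow>
      b \<in> topspace B \<and> (\<exists>V. openin (D b) V \<and> x \<in> V \<and> Groth_basic B D Dm b V \<subseteq> S))"
    (is "_ \<longleftrightarrow> ?R")
proof
  assume S: "openin (Groth B D Dm) S"
  show ?R
  proof (intro allI impI)
    fix b x assume bx: "(b, x) \<in> S"
    then obtain c V where c: "c \<in> topspace B" "openin (D c) V" "(b, x) \<in> Groth_basic B D Dm c V"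
        "Groth_basic B D Dm c V \<subseteq> S"
      using S unfolding openin_Groth[OF Alexandroff diagram] arbitrary_union_of_alt by blast
    then have le: "spec_le B b c" and x: "x \<in> topspace (D b)" "Dm b c x \<in> V"
      by (simp_all add: mem_Groth_basic_iff)
    have b: "b \<in> topspace B"
      using le by (simp add: spec_le_def)
    let ?V = "{x \<in> topspace (D b). Dm b c x \<in> V}"
    have "Groth_basic B D Dm b ?V \<subseteq> Groth_basic B D Dm c V"
    proof (rule subrelI)
      fix u y assume "(u, y) \<in> Groth_basic B D Dm b ?V"
      then show "(u, y) \<in> Groth_basic B D Dm c V"
        using Dm_comp[OF _ le, of u y] spec_le_trans[OF _ le, of u]
        by (simp add: mem_Groth_basic_iff[OF b] mem_Groth_basic_iff[OF c(1)])
    qed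
    moreover have "openin (D b) ?V"
      using openin_continuous_map_preimage[OF continuous_map_Dm[OF le] c(2)] .
    ultimately show "b \<in> topspace B \<and> (\<exists>V. openin (D b) V \<and> x \<in> V \<and> Groth_basic B D Dm b V \<subseteq> S)"
      using b x c(4) by blast
  qed
next
  assume R: ?R
  have "\<exists>T. openin (Groth B D Dm) T \<and> z \<in> T \<and> T \<subseteq> S" if "z \<in> S" for z
  proof -
    obtain b x where z: "z = (b, x)" by fastforce
    then obtain V where b: "b \<in> topspace B"
      and V: "openin (D b) V" "x \<in> V" "Groth_basic B D Dm b V \<subseteq> S"
      using R \<open>z \<in> S\<close> by blast
    moreover have "x \<in> topspace (D b)"
      using V openin_subset by blast
    ultimately show ?thesis
      using openin_Groth_basic[OF b V(1)]
      by (auto simp: z mem_Groth_basic_iff spec_le_refl Dm_id intro!: exI[of _ "Groth_basic B D Dm b V"])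
  qed
  then show "openin (Groth B D Dm) S"
    using openin_subopen by blast
qed

text \<open>A basic set at \<open>c\<close> tests a point over \<open>b\<close> only through its
  image in \<open>D c\<close>.\<close>

lemma mem_openin_Groth_if_mem_image:
  assumes "openin (Groth B D Dm) S" "spec_le B b c" "x \<in> topspace (D b)" "(c, Dm b c x) \<in> S"
  shows "(b, x) \<in> S"
proof -
  have "c \<in> topspace B"
    using assms(2) by (simp add: spec_le_def)
  moreover obtain V where "Dm b c x \<in> V" "Groth_basic B D Dm c V \<subseteq> S"
    using assms(1,4) unfolding openin_Groth_iff by blast
  ultimately show ?thesis
    using assms mem_Groth_basic_iff by blast
qed

lemma continuous_map_fst_Groth: "continuous_map (Groth B D Dm) B fst"
  unfolding continuous_map_def
proof (intro conjI allI impI)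
  show "fst \<in> topspace (Groth B D Dm) \<rightarrow> topspace B"
    by (auto simp: mem_topspace_Groth)
next
  fix U assume U: "openin B U"
  \<comment> \<open>With the whole of \<open>D b\<close> as \<open>V\<close>, the basic set is
    everything over the minimal neighbourhood of \<open>b\<close>, which lies in the lower set
    \<open>U\<close>.\<close>
  have "Groth_basic B D Dm b (topspace (D b)) \<subseteq> {z \<in> topspace (Groth B D Dm). fst z \<in> U}"
    if "b \<in> topspace B" "b \<in> U" for b
    using that mem_openin_if_spec_le[OF U]
    by (auto simp: mem_Groth_basic_iff mem_topspace_Groth spec_le_def)
  then show "openin (Groth B D Dm) {z \<in> topspace (Groth B D Dm). fst z \<in> U}"
    unfolding openin_Groth_iff by (auto simp: mem_topspace_Groth)
qed

lemma openin_Groth_over: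
  "openin B U \<Longrightarrow> openin (Groth B D Dm) {z \<in> topspace (Groth B D Dm). fst z \<in> U}"
  by (rule openin_continuous_map_preimage[OF continuous_map_fst_Groth])

end

section \<open>Consequences of a local trivialization\<close>

text \<open>One chart of a bundle, over an arbitrary open \<open>U\<close>. As open sets are lower
  sets, \<open>U\<close> contains the source of every arrow whose target it contains, so one chart
  sees both fibres.\<close>

locale Groth_trivialization = Top_diagram B D Dm
  for B :: "'b topology" and D :: "'b \<Rightarrow> 'a topology" and Dm :: "'b \<Rightarrow> 'b \<Rightarrow> 'a \<Rightarrow> 'a" +
  fixes F :: "'f topology" and U :: "'b set" and h :: "'b \<times> 'a \<Rightarrow> 'b \<times> 'f"
  assumes U: "openin B U"
    and hom: "homeomorphic_map
      (subtopology (Groth B D Dm) {z \<in> topspace (Groth B D Dm). fst z \<in> U})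
      (prod_topology (subtopology B U) F) h"
    and fst_h: "\<And>z. z \<in> topspace (Groth B D Dm) \<Longrightarrow> fst z \<in> U \<Longrightarrow> fst (h z) = fst z"
begin

abbreviation "over \<equiv> {z \<in> topspace (Groth B D Dm). fst z \<in> U}"

definition fibre_map :: "'b \<Rightarrow> 'a \<Rightarrow> 'f" where
  "fibre_map v x = snd (h (v, x))"

lemma U_subset: "v \<in> U \<Longrightarrow> v \<in> topspace B"
  using openin_subset[OF U] by blast

lemma h_eq: "v \<in> U \<Longrightarrow> x \<in> topspace (D v) \<Longrightarrow> h (v, x) = (v, fibre_map v x)"
  using fst_h[of "(v, x)"] U_subset by (simp add: mem_topspace_Groth fibre_map_def prod_eq_iff)

lemma openin_over: "openin (subtopology (Groth B D Dm) over) S \<longleftrightarrow> openin (Groth B D Dm) S \<and> S \<subseteq> over"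
  by (rule openin_open_subtopology[OF openin_Groth_over[OF U]])

lemma topspace_over: "topspace (subtopology (Groth B D Dm) over) = over"
  by auto

lemma inj_h: "inj_on h over"
  using homeomorphic_imp_injective_map[OF hom] by (simp only: topspace_over)

lemma surj_h: "h ` over = U \<times> topspace F"
  using homeomorphic_imp_surjective_map[OF hom] openin_subset[OF U]
  by (simp add: topspace_over Int_absorb1 del: topspace_subtopology) (simp add: Int_absorb1)

lemma Groth_basic_subset_over:
  "b \<in> U \<Longrightarrow> Groth_basic B D Dm b V \<subseteq> over"
  using mem_openin_if_spec_le[OF U] U_subset
  by (auto simp: mem_Groth_basic_iff mem_topspace_Groth)

lemma openin_h_image_Groth_basic:
  assumes "b \<in> U" "openin (D b) V"
  shows "openin (prod_topology (subtopology B U) F) (h ` Groth_basic B D Dm b V)"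
  using homeomorphic_imp_open_map[OF hom] openin_Groth_basic[OF U_subset assms(2)]
    Groth_basic_subset_over assms(1)
  by (simp add: open_map_def openin_over)

lemma openin_h_preimage:
  assumes "openin F G"
  shows "openin (Groth B D Dm) {z \<in> over. snd (h z) \<in> G}"
proof -
  have "continuous_map (subtopology (Groth B D Dm) over) F (snd \<circ> h)"
    using homeomorphic_imp_continuous_map[OF hom] continuous_map_snd by (rule continuous_map_compose)
  from openin_continuous_map_preimage[OF this assms] show ?thesis
    unfolding topspace_over openin_over by simp
qed

text \<open>Since \<open>Dm v v\<close> is the identity, a basic set at \<open>v\<close> meets the
  fibre over \<open>v\<close> exactly in \<open>V\<close>; openness upstairs thus restricts to
  openness in \<open>D v\<close>.\<close>

lemma fibre_map_openin_preimage:
  assumes v: "v \<in> U" and G: "openin F G"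
  shows "openin (D v) {x \<in> topspace (D v). fibre_map v x \<in> G}"
proof (subst openin_subopen, intro ballI)
  fix x assume "x \<in> {x \<in> topspace (D v). fibre_map v x \<in> G}"
  then have "(v, x) \<in> {z \<in> over. snd (h z) \<in> G}"
    using v U_subset by (simp add: mem_topspace_Groth fibre_map_def)
  then obtain V where V: "openin (D v) V" "x \<in> V"
      "Groth_basic B D Dm v V \<subseteq> {z \<in> over. snd (h z) \<in> G}"
    using openin_h_preimage[OF G] unfolding openin_Groth_iff by blast
  have "V \<subseteq> {x \<in> topspace (D v). fibre_map v x \<in> G}"
  proof
    fix y assume y: "y \<in> V"
    then have yD: "y \<in> topspace (D v)"
      using openin_subset[OF V(1)] by blast
    then have "(v, y) \<in> Groth_basic B D Dm v V"
      using y U_subset[OF v] by (simp add: mem_Groth_basic_iff spec_le_refl Dm_id)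
    then show "y \<in> {x \<in> topspace (D v). fibre_map v x \<in> G}"
      using V(3) yD by (auto simp: fibre_map_def)
  qed
  then show "\<exists>T. openin (D v) T \<and> x \<in> T \<and> T \<subseteq> {x \<in> topspace (D v). fibre_map v x \<in> G}"
    using V by blast
qed

text \<open>The chart preserves base points, so it restricts to a bijection of each slice. This
  yields (b).\<close>

lemma homeomorphic_map_fibre_map:
  assumes v: "v \<in> U"
  shows "homeomorphic_map (D v) F (fibre_map v)"
proof (rule bijective_open_imp_homeomorphic_map)
  have over: "(v, x) \<in> over \<longleftrightarrow> x \<in> topspace (D v)" for x
    using v U_subset by (simp add: mem_topspace_Groth)
  show "inj_on (fibre_map v) (topspace (D v))"
  proof (rule inj_onI)
    fix x y assume xy: "x \<in> topspace (D v)" "y \<in> topspace (D v)" "fibre_map v x = fibre_map v y"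
    then have "h (v, x) = h (v, y)"
      using h_eq[OF v] by simp
    then show "x = y"
      using inj_onD[OF inj_h] over xy by blast
  qed
  show surj: "fibre_map v ` topspace (D v) = topspace F"
  proof
    show "fibre_map v ` topspace (D v) \<subseteq> topspace F"
    proof clarify
      fix x assume x: "x \<in> topspace (D v)"
      then have "h (v, x) \<in> U \<times> topspace F"
        unfolding surj_h[symmetric] using over by (intro imageI) simp
      then show "fibre_map v x \<in> topspace F"
        using h_eq[OF v x] by simp
    qed
    show "topspace F \<subseteq> fibre_map v ` topspace (D v)"
    proof
      fix y assume "y \<in> topspace F"
      then have "(v, y) \<in> h ` over"
        unfolding surj_h using v by simp
      then obtain z where z: "(v, y) = h z" "z \<in> over"
        by (rule imageE)
      then have "fst z = v"
        using fst_h[of z] by (simp flip: z(1))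
      then show "y \<in> fibre_map v ` topspace (D v)"
        using z over[of "snd z"] by (intro image_eqI[of _ _ "snd z"]) (auto simp: fibre_map_def simp flip: z(1))
    qed
  qed
  show "continuous_map (D v) F (fibre_map v)"
    using fibre_map_openin_preimage[OF v] surj by (auto simp: continuous_map_def)
  show "open_map (D v) F (fibre_map v)"
    unfolding open_map_def
  proof (intro allI impI)
    fix W assume W: "openin (D v) W"
    let ?O = "h ` Groth_basic B D Dm v W"
    \<comment> \<open>For openness, the chart image of the basic set over \<open>W\<close> is cut by
      the slice at \<open>v\<close>. Only points over \<open>v\<close> land there, so the slice is
      the image of \<open>W\<close>.\<close>
    have "continuous_map F (prod_topology (subtopology B U) F) (Pair v)"
      using v U_subset by (intro continuous_map_pairedI) auto
    then have "openin F {y \<in> topspace F. (v, y) \<in> ?O}"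
      using openin_h_image_Groth_basic[OF v W] by (rule openin_continuous_map_preimage)
    moreover have "{y \<in> topspace F. (v, y) \<in> ?O} = fibre_map v ` W"
    proof (intro equalityI subsetI)
      fix y assume "y \<in> {y \<in> topspace F. (v, y) \<in> ?O}"
      then obtain u x where ux: "(u, x) \<in> Groth_basic B D Dm v W" "h (u, x) = (v, y)"
        by auto
      then have "(u, x) \<in> over"
        using Groth_basic_subset_over[OF v] by blast
      then have "u = v"
        using fst_h[of "(u, x)"] ux(2) by simp
      then show "y \<in> fibre_map v ` W"
        using ux U_subset[OF v]
        by (intro image_eqI[of _ _ x]) (auto simp: mem_Groth_basic_iff Dm_id fibre_map_def)
    next
      fix y assume "y \<in> fibre_map v ` W"
      then obtain x where x: "x \<in> W" "y = fibre_map v x" by blast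
      then have xD: "x \<in> topspace (D v)"
        using openin_subset[OF W] by blast
      then have "(v, x) \<in> Groth_basic B D Dm v W"
        using x U_subset[OF v] by (simp add: mem_Groth_basic_iff spec_le_refl Dm_id)
      then show "y \<in> {y \<in> topspace F. (v, y) \<in> ?O}"
        using h_eq[OF v xD] x surj xD by (auto simp: image_iff intro!: bexI[of _ "(v, x)"])
    qed
    ultimately show "openin F (fibre_map v ` W)"
      by simp
  qed
qed

text \<open>From left to right, an open set of the Grothendieck construction passes from
  \<open>(c, Dm b c x)\<close> down to \<open>(b, x)\<close>. From right to left, an open set of the
  product passes from \<open>c\<close> down to \<open>b\<close> at constant
  \<open>F\<close>-coordinate.\<close>

lemma fibre_map_Dm_mem_iff:
  assumes c: "c \<in> U" and le: "spec_le B b c" and x: "x \<in> topspace (D b)" and G: "openin F G"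
  shows "fibre_map c (Dm b c x) \<in> G \<longleftrightarrow> fibre_map b x \<in> G"
proof
  have b: "b \<in> U"
    using mem_openin_if_spec_le[OF U c le] .
  have Dx: "Dm b c x \<in> topspace (D c)"
    using Dm_in_topspace[OF le x] .
  {
    assume "fibre_map c (Dm b c x) \<in> G"
    then have "(c, Dm b c x) \<in> {z \<in> over. snd (h z) \<in> G}"
      using c Dx U_subset by (simp add: mem_topspace_Groth fibre_map_def)
    then have "(b, x) \<in> {z \<in> over. snd (h z) \<in> G}"
      by (rule mem_openin_Groth_if_mem_image[OF openin_h_preimage[OF G] le x])
    then show "fibre_map b x \<in> G"
      by (simp add: fibre_map_def)
  next
    assume mem: "fibre_map b x \<in> G"
    define V where "V = {y \<in> topspace (D c). fibre_map c y \<in> G}"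
    have V: "openin (D c) V"
      unfolding V_def by (rule fibre_map_openin_preimage[OF c G])
    have "fibre_map b x \<in> topspace F"
      using mem openin_subset[OF G] by blast
    \<comment> \<open>The point over \<open>c\<close> with the same \<open>F\<close>-coordinate as
      \<open>(b, x)\<close>.\<close>
    then obtain z where z: "z \<in> topspace (D c)" "fibre_map c z = fibre_map b x"
      using homeomorphic_imp_surjective_map[OF homeomorphic_map_fibre_map[OF c]] by (metis imageE)
    then have "(c, z) \<in> Groth_basic B D Dm c V"
      using mem U_subset[OF c] by (simp add: V_def mem_Groth_basic_iff spec_le_refl Dm_id)
    then have "(c, fibre_map b x) \<in> h ` Groth_basic B D Dm c V"
      using h_eq[OF c z(1)] z(2) by (metis image_eqI)
    then obtain U' G' where U': "openin (subtopology B U) U'" "c \<in> U'" "fibre_map b x \<in> G'"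
        "U' \<times> G' \<subseteq> h ` Groth_basic B D Dm c V"
      using openin_h_image_Groth_basic[OF c V] unfolding openin_prod_topology_alt by metis
    have "openin B U'"
      using U'(1) U openin_open_subtopology by blast
    \<comment> \<open>The first side of the box is a lower set, so the box also contains
      \<open>h (b, x)\<close>; injectivity of the chart pulls this back to the basic set.\<close>
    then have "b \<in> U'"
      using mem_openin_if_spec_le U'(2) le by blast
    then have "h (b, x) \<in> h ` Groth_basic B D Dm c V"
      using U' h_eq[OF b x] by auto
    moreover have "(b, x) \<in> over"
      using b x U_subset by (simp add: mem_topspace_Groth)
    ultimately have "(b, x) \<in> Groth_basic B D Dm c V"
      using inj_on_image_mem_iff[OF inj_h _ Groth_basic_subset_over[OF c]] by blast
    then show "fibre_map c (Dm b c x) \<in> G"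
      using U_subset[OF c] by (simp add: mem_Groth_basic_iff V_def)
  }
qed

text \<open>The homeomorphism goes from \<open>D b\<close> to \<open>F\<close> along the chart and
  back to \<open>D c\<close> by the inverse \<open>k\<close> of its restriction over
  \<open>c\<close>. An open \<open>V\<close> of \<open>D c\<close> is tested through its preimage
  under \<open>k\<close>, where the chart cannot separate \<open>x\<close> from
  \<open>Dm b c x\<close>.\<close>

lemma ex_homeomorphic_map_indistinguishable_Dm:
  assumes c: "c \<in> U" and le: "spec_le B b c"
  shows "\<exists>\<phi>. homeomorphic_map (D b) (D c) \<phi> \<and>
    (\<forall>x\<in>topspace (D b).
      Kolmogorov_quotient (D c) (\<phi> x) = Kolmogorov_quotient (D c) (Dm b c x))"
proof -
  have b: "b \<in> U"
    using mem_openin_if_spec_le[OF U c le] .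
  obtain k where k: "homeomorphic_maps (D c) F (fibre_map c) k"
    using homeomorphic_map_fibre_map[OF c] homeomorphic_map_maps by blast
  then have "homeomorphic_map F (D c) k"
    by (simp add: homeomorphic_maps_map)
  with homeomorphic_map_fibre_map[OF b] have "homeomorphic_map (D b) (D c) (k \<circ> fibre_map b)"
    by (rule homeomorphic_map_compose)
  moreover have "Kolmogorov_quotient (D c) (k (fibre_map b x)) =
      Kolmogorov_quotient (D c) (Dm b c x)" if x: "x \<in> topspace (D b)" for x
    unfolding Kolmogorov_quotient_eq
  proof (intro allI impI)
    fix V assume V: "openin (D c) V"
    have bx: "fibre_map b x \<in> topspace F"
      using homeomorphic_imp_surjective_map[OF homeomorphic_map_fibre_map[OF b]] x by blast
    have kV: "openin F {y \<in> topspace F. k y \<in> V}"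
      using k V by (simp add: homeomorphic_maps_def continuous_map_def)
    have "k (fibre_map c y) = y \<and> fibre_map c y \<in> topspace F" if "y \<in> topspace (D c)" for y
      using k that by (auto simp: homeomorphic_maps_def continuous_map_def)
    then show "k (fibre_map b x) \<in> V \<longleftrightarrow> Dm b c x \<in> V"
      using fibre_map_Dm_mem_iff[OF c le x kV] Dm_in_topspace[OF le x] bx by simp
  qed
  ultimately show ?thesis
    by auto
qed

end

section \<open>Trivialization over a minimal neighbourhood, and the bundle criterion\<close>

context Top_diagram
begin

text \<open>The chart sends \<open>(v, x)\<close> to \<open>(v, k (\<phi> v x))\<close>. Every
  \<open>v\<close> in the neighbourhood has an arrow to \<open>b\<close>, so all comparisons take
  place in \<open>D b\<close>, where open sets do not separate \<open>\<phi> v x\<close> from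
  \<open>Dm v b x\<close>.\<close>

lemma ex_trivialization_over_min_nbhd:
  assumes b: "b \<in> topspace B" and F: "D b homeomorphic_space F"
    and \<phi>: "\<And>v. spec_le B v b \<Longrightarrow> homeomorphic_map (D v) (D b) (\<phi> v)"
    and \<phi>_eq: "\<And>v x. spec_le B v b \<Longrightarrow> x \<in> topspace (D v) \<Longrightarrow>
      Kolmogorov_quotient (D b) (\<phi> v x) = Kolmogorov_quotient (D b) (Dm v b x)"
  shows "\<exists>h. homeomorphic_map
      (subtopology (Groth B D Dm) {z \<in> topspace (Groth B D Dm). fst z \<in> min_nbhd B b})
      (prod_topology (subtopology B (min_nbhd B b)) F) h \<and>
    (\<forall>z\<in>topspace (Groth B D Dm). fst z \<in> min_nbhd B b \<longrightarrow> fst (h z) = fst z)"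
proof -
  let ?U = "min_nbhd B b"
  let ?over = "{z \<in> topspace (Groth B D Dm). fst z \<in> ?U}"
  let ?E = "subtopology (Groth B D Dm) ?over" and ?P = "prod_topology (subtopology B ?U) F"
  have U: "openin B ?U"
    by (rule openin_min_nbhd[OF Alexandroff b])
  have memU: "v \<in> ?U \<longleftrightarrow> spec_le B v b" for v
    by (rule mem_min_nbhd_iff[OF Alexandroff b])
  have over: "(v, x) \<in> ?over \<longleftrightarrow> spec_le B v b \<and> x \<in> topspace (D v)" for v x
    by (auto simp: mem_topspace_Groth memU spec_le_def)
  have openE: "openin ?E S \<longleftrightarrow> openin (Groth B D Dm) S \<and> S \<subseteq> ?over" for S
    by (rule openin_open_subtopology[OF openin_Groth_over[OF U]])
  have topE: "topspace ?E = ?over" by auto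
  have openU: "openin (subtopology B ?U) S \<longleftrightarrow> openin B S \<and> S \<subseteq> ?U" for S
    by (rule openin_open_subtopology[OF U])
  obtain k where k: "homeomorphic_map (D b) F k"
    using F by (auto simp: homeomorphic_space_def homeomorphic_map_maps)
  define \<psi> where "\<psi> v = k \<circ> \<phi> v" for v
  have \<psi>: "homeomorphic_map (D v) F (\<psi> v)" if "spec_le B v b" for v
    unfolding \<psi>_def using \<phi>[OF that] k by (rule homeomorphic_map_compose)
  have \<psi>_surj: "\<psi> v ` topspace (D v) = topspace F" if "spec_le B v b" for v
    using homeomorphic_imp_surjective_map[OF \<psi>[OF that]] .
  have \<phi>_mem: "\<phi> v x \<in> V \<longleftrightarrow> Dm v b x \<in> V"
    if "spec_le B v b" "x \<in> topspace (D v)" "openin (D b) V" for v x V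
    using \<phi>_eq[OF that(1,2)] that(3) Kolmogorov_quotient_eq by metis
  have \<phi>_in: "\<phi> v x \<in> topspace (D b)" if "spec_le B v b" "x \<in> topspace (D v)" for v x
    using homeomorphic_imp_surjective_map[OF \<phi>[OF that(1)]] that(2) by blast
  define h where "h z = (fst z, \<psi> (fst z) (snd z))" for z
  have surj: "h ` topspace ?E = topspace ?P"
  proof (intro equalityI subsetI)
    fix w assume "w \<in> h ` topspace ?E"
    then obtain v x where vx: "(v, x) \<in> ?over" "w = (v, \<psi> v x)"
      unfolding topE h_def by force
    then have v: "spec_le B v b" "x \<in> topspace (D v)"
      using over by blast+
    then have "\<psi> v x \<in> topspace F"
      using \<psi>_surj by blast
    moreover have "v \<in> topspace B" "v \<in> ?U"
      using v memU by (simp_all add: spec_le_def)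
    ultimately show "w \<in> topspace ?P"
      using vx by simp
  next
    fix w assume w: "w \<in> topspace ?P"
    obtain v y where "w = (v, y)" by fastforce
    with w have v: "w = (v, y)" "spec_le B v b" "y \<in> topspace F"
      using memU by auto
    then obtain x where "x \<in> topspace (D v)" "y = \<psi> v x"
      using \<psi>_surj by blast
    then show "w \<in> h ` topspace ?E"
      unfolding topE using v over by (intro image_eqI[of _ _ "(v, x)"]) (simp_all add: h_def)
  qed
  have inj: "inj_on h (topspace ?E)"
    unfolding topE
  proof (rule inj_onI)
    fix z w assume zw: "z \<in> ?over" "w \<in> ?over" "h z = h w"
    obtain v x u y where eq: "z = (v, x)" "w = (u, y)" by fastforce
    then have vx: "spec_le B v b" "x \<in> topspace (D v)" "y \<in> topspace (D v)" "u = v" "\<psi> v x = \<psi> v y"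
      using zw over by (auto simp: h_def)
    then show "z = w"
      using inj_onD[OF homeomorphic_imp_injective_map[OF \<psi>]] eq by blast
  qed
  have "openin ?E {z \<in> topspace ?E. \<psi> (fst z) (snd z) \<in> G}" if G: "openin F G" for G
  proof -
    \<comment> \<open>\<open>G\<close> transported to \<open>D b\<close>; the preimage of
      \<open>G\<close> under the second coordinate turns out to be the basic set of \<open>V\<close>
      at \<open>b\<close>.\<close>
    define V where "V = {x \<in> topspace (D b). k x \<in> G}"
    have V: "openin (D b) V"
      unfolding V_def using homeomorphic_imp_continuous_map[OF k] G
      by (rule openin_continuous_map_preimage)
    have "\<psi> v x \<in> G \<longleftrightarrow> Dm v b x \<in> V" if "spec_le B v b" "x \<in> topspace (D v)" for v x
      using \<phi>_mem[OF that V] \<phi>_in[OF that] by (simp add: V_def \<psi>_def)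
    then have "(v, x) \<in> ?over \<and> \<psi> v x \<in> G \<longleftrightarrow> (v, x) \<in> Groth_basic B D Dm b V" for v x
      unfolding over mem_Groth_basic_iff[OF b] by blast
    then have "{z \<in> topspace ?E. \<psi> (fst z) (snd z) \<in> G} = Groth_basic B D Dm b V"
      by (simp only: topE set_eq_iff split_paired_All mem_Collect_eq fst_conv snd_conv simp_thms)
    moreover have "Groth_basic B D Dm b V \<subseteq> ?over"
      using over by (intro subrelI) (simp only: mem_Groth_basic_iff[OF b])
    ultimately show ?thesis
      using openin_Groth_basic[OF b V] openE by simp
  qed
  moreover have "\<psi> (fst z) (snd z) \<in> topspace F" if "z \<in> topspace ?E" for z
    using that \<psi>_surj over[of "fst z" "snd z"] unfolding topE by auto
  ultimately have "continuous_map ?E F (\<lambda>z. \<psi> (fst z) (snd z))"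
    by (simp add: continuous_map_def del: topspace_subtopology)
  moreover have "continuous_map ?E (subtopology B ?U) fst"
    using continuous_map_from_subtopology[OF continuous_map_fst_Groth]
    by (auto simp: continuous_map_in_subtopology)
  ultimately have cont: "continuous_map ?E ?P h"
    unfolding h_def by (intro continuous_map_pairedI)
  have open_h: "open_map ?E ?P h"
    unfolding open_map_def
  proof (intro allI impI)
    fix S assume S: "openin ?E S"
    show "openin ?P (h ` S)"
      unfolding openin_prod_topology_alt
    proof (intro allI impI)
      fix c y assume "(c, y) \<in> h ` S"
      then obtain x where x: "(c, x) \<in> S" "y = \<psi> c x"
        by (auto simp: h_def)
      have c: "spec_le B c b" "x \<in> topspace (D c)"
        using S x(1) openE over[of c x] by blast+
      have cB: "c \<in> topspace B"
        using c(1) by (simp add: spec_le_def)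
      have "openin (Groth B D Dm) S"
        using S openE by blast
      then obtain V where V: "openin (D c) V" "x \<in> V" "Groth_basic B D Dm c V \<subseteq> S"
        using x(1) unfolding openin_Groth_iff by blast
      \<comment> \<open>\<open>V\<close> is moved to \<open>D b\<close>, where
        \<open>\<phi> u\<close> and \<open>\<phi> c\<close> can be compared for \<open>u\<close>
        below \<open>c\<close>.\<close>
      have V': "openin (D b) (\<phi> c ` V)"
        using homeomorphic_imp_open_map[OF \<phi>[OF c(1)]] V(1) by (simp add: open_map_def)
      have G: "openin F (\<psi> c ` V)"
        using homeomorphic_imp_open_map[OF \<psi>[OF c(1)]] V(1) by (simp add: open_map_def)
      have "min_nbhd B c \<times> \<psi> c ` V \<subseteq> h ` S"
      proof clarify
        fix u w assume u: "u \<in> min_nbhd B c" and w: "w \<in> V"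
        have uc: "spec_le B u c"
          using u mem_min_nbhd_iff[OF Alexandroff cB] by simp
        have ub: "spec_le B u b"
          using spec_le_trans[OF uc c(1)] .
        have wD: "w \<in> topspace (D c)"
          using w openin_subset[OF V(1)] by blast
        \<comment> \<open>The only candidate over \<open>u\<close> for a preimage of
          \<open>(u, \<psi> c w)\<close>. To see that \<open>Dm u c a\<close> lies in
          \<open>V\<close>, replace \<open>\<phi> u\<close> by \<open>Dm u b\<close>, factor through
          \<open>Dm u c\<close>, replace \<open>Dm c b\<close> by \<open>\<phi> c\<close>, and
          cancel \<open>\<phi> c\<close> by injectivity.\<close>
        obtain a where a: "a \<in> topspace (D u)" "\<phi> u a = \<phi> c w"
          using homeomorphic_imp_surjective_map[OF \<phi>[OF ub]] \<phi>_in[OF c(1) wD] by (metis imageE)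
        have "Dm u b a \<in> \<phi> c ` V"
          using \<phi>_mem[OF ub a(1) V'] a(2) w by simp
        then have "Dm c b (Dm u c a) \<in> \<phi> c ` V"
          using Dm_comp[OF uc c(1) a(1)] by simp
        then have "\<phi> c (Dm u c a) \<in> \<phi> c ` V"
          using \<phi>_mem[OF c(1) Dm_in_topspace[OF uc a(1)] V'] by simp
        then have "Dm u c a \<in> V"
          using inj_on_image_mem_iff[OF homeomorphic_imp_injective_map[OF \<phi>[OF c(1)]]
              Dm_in_topspace[OF uc a(1)] openin_subset[OF V(1)]] by simp
        then have "(u, a) \<in> S"
          using V(3) uc a(1) mem_Groth_basic_iff[OF cB] by blast
        moreover have "h (u, a) = (u, \<psi> c w)"
          using a(2) by (simp add: h_def \<psi>_def)
        ultimately show "(u, \<psi> c w) \<in> h ` S"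
          by (metis image_eqI)
      qed
      moreover have "openin (subtopology B ?U) (min_nbhd B c)"
        using openin_min_nbhd[OF Alexandroff cB] c(1) openU by (simp add: spec_le_def)
      moreover have "y \<in> \<psi> c ` V"
        using x(2) V(2) by simp
      ultimately show "\<exists>U V. openin (subtopology B ?U) U \<and> openin F V \<and> c \<in> U \<and> y \<in> V \<and>
          U \<times> V \<subseteq> h ` S"
        using G min_nbhd_self
        by (intro exI[of _ "min_nbhd B c"] exI[of _ "\<psi> c ` V"] conjI)
    qed
  qed
  have "homeomorphic_map ?E ?P h"
    using bijective_open_imp_homeomorphic_map[OF cont open_h surj inj] .
  then show ?thesis
    by (intro exI[of _ h]) (simp add: h_def)
qed

text \<open>The meeting point of both directions, with (a) and (c) still merged arrow by arrow. A
  chart around the target of an arrow handles that arrow; conversely, the arrows into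
  \<open>b\<close> give a chart over its minimal neighbourhood.\<close>

lemma fiber_bundle_Groth_iff:
  "fiber_bundle (Groth B D Dm) B F fst \<longleftrightarrow>
    (\<forall>b\<in>topspace B. D b homeomorphic_space F) \<and>
    (\<forall>b c. spec_le B b c \<longrightarrow> (\<exists>\<phi>. homeomorphic_map (D b) (D c) \<phi> \<and>
      (\<forall>x\<in>topspace (D b).
        Kolmogorov_quotient (D c) (\<phi> x) = Kolmogorov_quotient (D c) (Dm b c x))))"
    (is "?bundle \<longleftrightarrow> ?fibres \<and> ?maps")
proof
  assume ?bundle
  then have "\<exists>U h. c \<in> U \<and> Groth_trivialization B D Dm F U h" if "c \<in> topspace B" for c
    using that Top_diagram_axioms
    unfolding fiber_bundle_def Groth_trivialization_def Groth_trivialization_axioms_def by meson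
  then obtain U h where triv: "\<And>c. c \<in> topspace B \<Longrightarrow> c \<in> U c"
      "\<And>c. c \<in> topspace B \<Longrightarrow> Groth_trivialization B D Dm F (U c) (h c)"
    by metis
  show "?fibres \<and> ?maps"
  proof (intro conjI ballI allI impI)
    fix b assume "b \<in> topspace B"
    then show "D b homeomorphic_space F"
      using Groth_trivialization.homeomorphic_map_fibre_map triv
        homeomorphic_map_imp_homeomorphic_space by metis
  next
    fix b c assume "spec_le B b c"
    then show "\<exists>\<phi>. homeomorphic_map (D b) (D c) \<phi> \<and> (\<forall>x\<in>topspace (D b).
        Kolmogorov_quotient (D c) (\<phi> x) = Kolmogorov_quotient (D c) (Dm b c x))"
      using Groth_trivialization.ex_homeomorphic_map_indistinguishable_Dm[OF triv(2) triv(1)]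
      by (simp add: spec_le_def)
  qed
next
  assume R: "?fibres \<and> ?maps"
  then obtain \<phi> where \<phi>: "\<And>b c. spec_le B b c \<Longrightarrow> homeomorphic_map (D b) (D c) (\<phi> b c)"
      "\<And>b c x. spec_le B b c \<Longrightarrow> x \<in> topspace (D b) \<Longrightarrow>
        Kolmogorov_quotient (D c) (\<phi> b c x) = Kolmogorov_quotient (D c) (Dm b c x)"
    by metis
  show ?bundle
    unfolding fiber_bundle_def
  proof (intro conjI ballI continuous_map_fst_Groth)
    fix b assume b: "b \<in> topspace B"
    show "\<exists>U h. openin B U \<and> b \<in> U \<and>
        homeomorphic_map (subtopology (Groth B D Dm) {x \<in> topspace (Groth B D Dm). fst x \<in> U})
          (prod_topology (subtopology B U) F) h \<and>
        (\<forall>x\<in>topspace (Groth B D Dm). fst x \<in> U \<longrightarrow> fst (h x) = fst x)"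
    proof -
      obtain h where "homeomorphic_map
            (subtopology (Groth B D Dm) {x \<in> topspace (Groth B D Dm). fst x \<in> min_nbhd B b})
            (prod_topology (subtopology B (min_nbhd B b)) F) h"
          "\<forall>x\<in>topspace (Groth B D Dm). fst x \<in> min_nbhd B b \<longrightarrow> fst (h x) = fst x"
        using ex_trivialization_over_min_nbhd[OF b bspec[OF conjunct1[OF R] b] \<phi>] by blast
      then show ?thesis
        using openin_min_nbhd[OF Alexandroff b] min_nbhd_self
        by (intro exI[of _ "min_nbhd B b"] exI[of _ h] conjI)
    qed
  qed
qed

end

theorem theorem3p12:
  fixes B :: "'b topology" and F :: "'f topology"
    and D :: "'b \<Rightarrow> 'a topology" and Dm :: "'b \<Rightarrow> 'b \<Rightarrow> 'a \<Rightarrow> 'a"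
  assumes "Alexandroff_space B"
    and "functor_to_Top B D Dm"
  shows "fiber_bundle (Groth B D Dm) B F fst \<longleftrightarrow>
    (functor_to_Top0 B (\<lambda>b. Kspace (D b)) (\<lambda>b1 b2. Kmap (D b1) (D b2) (Dm b1 b2)) \<and>
     morphism_inverting B (\<lambda>b. Kspace (D b)) (\<lambda>b1 b2. Kmap (D b1) (D b2) (Dm b1 b2))) \<and>
    (\<forall>b\<in>topspace B. D b homeomorphic_space F) \<and>
    (\<forall>b1 b2. spec_le B b1 b2 \<longrightarrow>
      (\<forall>y\<in>topspace (Kspace (D b2)). \<exists>f.
        bij_betw f
          {x \<in> topspace (D b1). Kolmogorov_quotient (D b1) x \<in>
             {z \<in> topspace (Kspace (D b1)). Kmap (D b1) (D b2) (Dm b1 b2) z = y}}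
          {x \<in> topspace (D b2). Kolmogorov_quotient (D b2) x = y}))"
proof -
  interpret Top_diagram B D Dm
    using assms by unfold_locales
  \<comment> \<open>The arrowwise equivalence splits the merged condition, and distributing the
    quantifier over arrows separates (a) from (c).\<close>
  show ?thesis
    by (simp only: fiber_bundle_Groth_iff morphism_inverting_def functor_to_Top0_Kspace[OF diagram]
        homeomorphic_Kmap_fibres_iff[OF continuous_map_Dm, symmetric] imp_conjR all_conj_distrib
        simp_thms conj_ac cong: imp_cong)
qed

end
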